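(* Let $a_1,\ldots,a_m$ ($m\ge1$) be nonzero integers, let $r=[2a_1,2a_2,\ldots,2a_m]$, and let $K(r)$ be the corresponding two-bridge knot (or two-component two-bridge link). If among $a_1,\ldots,a_m$ there are no two consecutive $1$ and no two consecutive $-1$ (namely, $a_ia_{i+1}\neq 1$ for $i=1,\ldots,m-1$), then every zero $\alpha\in\mathbb{C}$ of the Alexander polynomial $\Delta_{K(r)}(t)$ satisfies $\operatorname{Re}(\alpha)>-1$. If moreover $|a_i|>1$ for $i=1,2,\ldots,m$, then every zero $\alpha$ of $\Delta_{K(r)}(t)$ satisfies $$-1<\operatorname{Re}(\alpha)<3.$$
   Context: For nonzero integers $a_1,\ldots,a_m$, the notation $[2a_1,\ldots,2a_m]$ denotes the even negative continued fraction $$[2a_1,2a_2,\ldots,2a_m]:=\cfrac{1}{2a_1-\cfrac{1}{2a_2-\cfrac{1}{\ddots-\cfrac{1}{2a_m}}}}.$$ $K(r)$ denotes the two-bridge knot ($m$ even) or two-component two-bridge link ($m$ odd) identified by the rational number $r$. The expansion gives a diagram of $K(r)$ and a minimal genus Seifert surface whose Seifert matrix is the $m\times m$ matrix $U=(u_{ij})$ with $u_{ii}=a_i$ for all $i$; $u_{i,i-1}=-1$ for every even $i$ with $2\le i\le m$; $u_{i,i+1}=1$ for every even $i$ with $i+1\le m$; and all other entries $0$. The Alexander polynomial is $\Delta_{K(r)}(t)=\det(tU-U^T)$ with this $U$. *)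

theory Defs
  imports Complex_Main "Jordan_Normal_Form.Determinant"
begin

text \<open>A list \<open>[a\<^sub>1, \<dots>, a\<^sub>m]\<close> of integers encodes the
  even negative continued fraction \<open>[2a\<^sub>1, \<dots>, 2a\<^sub>m]\<close>. If all
  entries are nonzero, no denominator vanishes.\<close>

fun even_cf :: "int list \<Rightarrow> rat" where
  "even_cf [] = 0"
| "even_cf (a # as) = 1 / (2 * of_int a - even_cf as)"

definition even_expansion :: "int list \<Rightarrow> rat \<Rightarrow> bool" where
  "even_expansion a r \<longleftrightarrow> a \<noteq> [] \<and> (\<forall>x \<in> set a. x \<noteq> 0) \<and> r = even_cf a"

text \<open>Matrix indices start at 0, so the even rows of the usual 1-based
  description are the rows with odd index here.\<close>

definition seifert_matrix :: "int list \<Rightarrow> int mat" where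
  "seifert_matrix a = mat (length a) (length a) (\<lambda>(i, j).
     if j = i then a ! i
     else if odd i \<and> i = j + 1 then - 1
     else if odd i \<and> j = i + 1 then 1
     else 0)"

text \<open>\<open>det (t U - U\<^sup>T)\<close> over \<open>\<int>[t]\<close>, where \<open>[:0, 1:]\<close> is \<open>t\<close>.\<close>

definition seifert_alexander :: "int mat \<Rightarrow> int poly" where
  "seifert_alexander U =
     det ([:0, 1:] \<cdot>\<^sub>m map_mat (\<lambda>c. [:c:]) U - map_mat (\<lambda>c. [:c:]) (transpose_mat U))"

text \<open>The Alexander polynomial of the two-bridge knot or link \<open>K(r)\<close>, computed from the
  Seifert surface given by the even expansion of \<open>r\<close>; that expansion is unique
  (see \<open>even_expansion_unique\<close>). Rationals without an even
  expansion get an arbitrary value.\<close>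

definition alexander_two_bridge :: "rat \<Rightarrow> int poly" where
  "alexander_two_bridge r = seifert_alexander (seifert_matrix (THE a. even_expansion a r))"

lemma even_cf_abs_less_1:
  assumes "\<forall>x \<in> set a. x \<noteq> 0"
  shows "\<bar>even_cf a\<bar> < 1"
  using assms
proof (induction a)
  case (Cons x a)
  then have "\<bar>even_cf a\<bar> < 1" "\<bar>x\<bar> \<ge> 1" by auto
  moreover from this(2) have "\<bar>rat_of_int x\<bar> \<ge> 1"
    by (simp flip: of_int_abs)
  ultimately have "\<bar>2 * rat_of_int x - even_cf a\<bar> > 1" by linarith
  then show ?case by (simp add: abs_divide divide_less_eq)
qed simp

lemma even_cf_denominator_nonzero:
  assumes "\<forall>x \<in> set (x # a). x \<noteq> 0"
  shows "2 * of_int x - even_cf a \<noteq> 0"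
proof -
  have "\<bar>even_cf a\<bar> < 1" using assms by (intro even_cf_abs_less_1) auto
  moreover have "\<bar>rat_of_int x\<bar> \<ge> 1"
    using assms by (simp flip: of_int_abs) linarith
  ultimately show ?thesis by linarith
qed

lemma even_cf_inject:
  assumes "\<forall>x \<in> set a. x \<noteq> 0" "\<forall>x \<in> set b. x \<noteq> 0" "even_cf a = even_cf b"
  shows "a = b"
  using assms
proof (induction a arbitrary: b)
  case Nil
  then show ?case
    using even_cf_denominator_nonzero [of "hd b" "tl b"] by (cases b) simp_all
next
  case (Cons x a)
  have nz: "2 * of_int x - even_cf a \<noteq> 0"
    using Cons.prems(1) by (rule even_cf_denominator_nonzero)
  then obtain y b' where b: "b = y # b'"
    using Cons.prems(3) by (cases b) simp_all
  have eq: "2 * of_int x - even_cf a = 2 * of_int y - even_cf b'"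
    using Cons.prems(3) by (simp add: b divide_inverse)
  have "\<bar>even_cf a\<bar> < 1" "\<bar>even_cf b'\<bar> < 1"
    using Cons.prems(1,2) by (simp_all add: b even_cf_abs_less_1)
  with eq have "\<bar>rat_of_int x - rat_of_int y\<bar> < 1" by linarith
  then have "\<bar>rat_of_int (x - y)\<bar> < rat_of_int 1" by simp
  then have "x = y" unfolding of_int_abs [symmetric] of_int_less_iff by simp
  moreover from this eq have "even_cf a = even_cf b'" by simp
  then have "a = b'"
    using Cons.prems(1,2) by (intro Cons.IH) (simp_all add: b)
  ultimately show ?case by (simp add: b)
qed

lemma even_expansion_unique:
  "even_expansion a r \<Longrightarrow> even_expansion b r \<Longrightarrow> a = b"
  unfolding even_expansion_def by (rule even_cf_inject) simp_all

lemma alexander_two_bridge_eq: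
  assumes "even_expansion a r"
  shows "alexander_two_bridge r = seifert_alexander (seifert_matrix a)"
proof -
  have "(THE a. even_expansion a r) = a"
    using assms even_expansion_unique [OF _ assms] by (rule the_equality)
  then show ?thesis by (simp add: alexander_two_bridge_def)
qed

end

theory Submission imports Defs "Jordan_Normal_Form.Char_Poly" begin

text \<open>The matrix \<open>t U - U\<^sup>T\<close> is tridiagonal, so its leading principal minors satisfy
  \<open>D\<^sub>n\<^sub>+\<^sub>2 = b\<^sub>n\<^sub>+\<^sub>1 D\<^sub>n\<^sub>+\<^sub>1 + t D\<^sub>n\<close> with \<open>b\<^sub>i = a\<^sub>i (t - 1)\<close>. The normalised ratios
  \<open>w\<^sub>n = D\<^sub>n\<^sub>+\<^sub>1 / (b\<^sub>n D\<^sub>n)\<close> obey \<open>w\<^sub>n\<^sub>+\<^sub>1 = 1 + e\<^sub>n / w\<^sub>n\<close> with \<open>e\<^sub>n = t / (b\<^sub>n b\<^sub>n\<^sub>+\<^sub>1)\<close>. As in the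
  parabola theorem for continued fractions, the half-plane \<open>Re w \<ge> 1/2\<close> is invariant as
  long as \<open>\<bar>e\<bar> - Re e \<le> 1/2\<close>, and this holds for \<open>Re t \<le> -1\<close> when \<open>a\<^sub>n a\<^sub>n\<^sub>+\<^sub>1 \<noteq> 1\<close>, and for
  \<open>Re t \<ge> 3\<close> when \<open>\<bar>a\<^sub>n a\<^sub>n\<^sub>+\<^sub>1\<bar> \<ge> 4\<close>. So no minor vanishes there.\<close>

text \<open>The entries are functions on all of \<open>nat\<close>, so the leading principal minors
  of one matrix share \<open>d\<close>, \<open>l\<close>, \<open>u\<close> and differ only in
  \<open>n\<close>.\<close>

definition tridiagonal_mat ::
  "(nat \<Rightarrow> 'a) \<Rightarrow> (nat \<Rightarrow> 'a) \<Rightarrow> (nat \<Rightarrow> 'a) \<Rightarrow> nat \<Rightarrow> 'a::zero mat" where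
  "tridiagonal_mat d l u n = mat n n (\<lambda>(i, j).
     if i = j then d i else if i = Suc j then l j else if j = Suc i then u i else 0)"

lemma tridiagonal_mat_carrier [simp]: "tridiagonal_mat d l u n \<in> carrier_mat n n"
  by (simp add: tridiagonal_mat_def)

lemma det_tridiagonal_mat_0: "det (tridiagonal_mat d l u 0) = (1 :: 'a :: comm_ring_1)"
  by (simp add: det_dim_zero)

lemma det_tridiagonal_mat_1: "det (tridiagonal_mat d l u 1) = (d 0 :: 'a :: comm_ring_1)"
  by (subst det_single) (simp_all add: tridiagonal_mat_def)

text \<open>Laplace expansion along the last row leaves two terms; the minor belonging to
  \<open>l n\<close> is expanded again, along its last column.\<close>

lemma det_tridiagonal_mat_rec:
  fixes d l u :: "nat \<Rightarrow> 'a :: comm_ring_1"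
  shows "det (tridiagonal_mat d l u (Suc (Suc n))) =
    d (Suc n) * det (tridiagonal_mat d l u (Suc n)) - l n * u n * det (tridiagonal_mat d l u n)"
proof -
  let ?A = "tridiagonal_mat d l u"
  let ?B = "mat_delete (?A (Suc (Suc n))) (Suc n) n"
  have B: "?B \<in> carrier_mat (Suc n) (Suc n)"
    unfolding mat_delete_def by (simp add: tridiagonal_mat_def)
  have "det ?B = (\<Sum>i<Suc n. ?B $$ (i, n) * cofactor ?B i n)"
    by (rule laplace_expansion_column [OF B]) simp
  \<comment> \<open>With column \<open>n\<close> deleted, the last column of \<open>?B\<close> comes
    from column \<open>Suc n\<close>, whose only nonzero entry above the diagonal can be
    \<open>u n\<close>.\<close>
  also have "\<dots> = u n * cofactor ?B n n"
    by (simp add: mat_delete_def tridiagonal_mat_def)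
  also have "mat_delete ?B n n = ?A n"
    by (rule eq_matI) (auto simp: mat_delete_def tridiagonal_mat_def)
  then have "cofactor ?B n n = det (?A n)"
    by (simp add: cofactor_def flip: mult_2)
  finally have minor: "det ?B = u n * det (?A n)" .
  have "det (?A (Suc (Suc n))) =
      (\<Sum>j<Suc (Suc n). ?A (Suc (Suc n)) $$ (Suc n, j) * cofactor (?A (Suc (Suc n))) (Suc n) j)"
    by (rule laplace_expansion_row) simp_all
  also have "\<dots> = l n * cofactor (?A (Suc (Suc n))) (Suc n) n
      + d (Suc n) * cofactor (?A (Suc (Suc n))) (Suc n) (Suc n)"
    by (simp add: tridiagonal_mat_def)
  also have "mat_delete (?A (Suc (Suc n))) (Suc n) (Suc n) = ?A (Suc n)"
    by (rule eq_matI) (auto simp: mat_delete_def tridiagonal_mat_def)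
  then have "cofactor (?A (Suc (Suc n))) (Suc n) (Suc n) = det (?A (Suc n))"
    by (simp add: cofactor_def flip: mult_2)
  also have "cofactor (?A (Suc (Suc n))) (Suc n) n = - (u n * det (?A n))"
    by (simp add: cofactor_def minor)
  finally show ?thesis by (simp add: algebra_simps)
qed

text \<open>\<open>Re w \<ge> 1/2\<close> says that \<open>w\<close> is at least as close to 1 as to
  0, so \<open>(1 - w) / w\<close> has modulus at most 1. Hence
  \<open>e / w = e + e * ((1 - w) / w)\<close> has real part at least
  \<open>Re e - cmod e\<close>.\<close>

lemma parabola_half_plane:
  fixes e w :: complex
  assumes "cmod e - Re e \<le> 1/2" "Re w \<ge> 1/2"
  shows "Re (1 + e / w) \<ge> 1/2"
proof -
  have "w \<noteq> 0" using assms(2) by auto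
  have "(cmod (1 - w))\<^sup>2 \<le> (cmod w)\<^sup>2"
    using assms(2) unfolding cmod_power2 by (simp add: power2_eq_square algebra_simps)
  then have "cmod ((1 - w) / w) \<le> 1"
    using \<open>w \<noteq> 0\<close> by (simp add: norm_divide)
  then have "cmod (e * ((1 - w) / w)) \<le> cmod e"
    by (metis mult.right_neutral mult_left_mono norm_ge_zero norm_mult)
  moreover have "e / w = e + e * ((1 - w) / w)"
    using \<open>w \<noteq> 0\<close> by (simp add: field_simps)
  moreover have "- Re (e * ((1 - w) / w)) \<le> cmod (e * ((1 - w) / w))"
    using abs_Re_le_cmod by (rule abs_le_D2)
  ultimately show ?thesis using assms(1) by simp
qed

lemma continuant_nonzero:
  fixes D b :: "nat \<Rightarrow> complex" and t :: complex
  assumes D: "D 0 = 1" "D 1 = b 0" "\<And>n. D (Suc (Suc n)) = b (Suc n) * D (Suc n) + t * D n"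
    and b: "\<And>i. i < N \<Longrightarrow> b i \<noteq> 0"
    and e: "\<And>i. Suc i < N \<Longrightarrow>
      cmod (t / (b i * b (Suc i))) - Re (t / (b i * b (Suc i))) \<le> 1/2"
  shows "D N \<noteq> 0"
proof -
  have "D n \<noteq> 0 \<and> Re (D (Suc n) / (b n * D n)) \<ge> 1/2" if "n < N" for n
    using that
  proof (induction n)
    case 0
    then show ?case using D b [of 0] by simp
  next
    case (Suc n)
    let ?w = "D (Suc n) / (b n * D n)"
    have IH: "D n \<noteq> 0" "Re ?w \<ge> 1/2" using Suc by simp_all
    \<comment> \<open>A vanishing numerator would make \<open>?w\<close> zero, against
      \<open>Re ?w \<ge> 1/2\<close>.\<close>
    then have nz: "D (Suc n) \<noteq> 0" by auto
    have "D (Suc (Suc n)) / (b (Suc n) * D (Suc n)) = 1 + t / (b n * b (Suc n)) / ?w"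
      using nz IH(1) b [of n] b [of "Suc n"] Suc.prems by (simp add: D(3) field_simps)
    then show ?case
      using nz parabola_half_plane [OF e [OF Suc.prems] IH(2)] by metis
  qed
  from this [of "N - 1"] D(1) show ?thesis by (cases N) auto
qed

text \<open>Off the diagonal, only rows of odd index in \<open>U\<close> are nonzero, so the entries
  alternate with parity. The product of opposite entries is always \<open>-t\<close>, which gives
  the recurrence its uniform coefficient \<open>t\<close>.\<close>

lemma seifert_alexander_tridiagonal:
  "seifert_alexander (seifert_matrix a) =
    det (tridiagonal_mat (\<lambda>i. [:- (a ! i), a ! i:]) (\<lambda>j. if even j then [:0, - 1:] else - 1)
      (\<lambda>i. if even i then 1 else [:0, 1:]) (length a))"
  unfolding seifert_alexander_def
  by (rule arg_cong [where f = det], rule eq_matI)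
    (auto simp: seifert_matrix_def tridiagonal_mat_def one_pCons)

lemma seifert_alexander_nonzero:
  fixes t :: complex
  assumes "t \<noteq> 1" "\<forall>x \<in> set a. x \<noteq> 0"
    and e: "\<And>i. Suc i < length a \<Longrightarrow>
      cmod (t / (t - 1)\<^sup>2 / of_int (a ! i * a ! Suc i))
        - Re (t / (t - 1)\<^sup>2 / of_int (a ! i * a ! Suc i)) \<le> 1/2"
  shows "poly (map_poly of_int (seifert_alexander (seifert_matrix a))) t \<noteq> 0"
proof -
  define A where "A = tridiagonal_mat (\<lambda>i. [:- (a ! i), a ! i:])
    (\<lambda>j. if even j then [:0, - 1:] else - 1) (\<lambda>i. if even i then 1 else [:0, 1:])"
  define D where "D n = poly (map_poly of_int (det (A n))) t" for n
  define b where "b i = of_int (a ! i) * (t - 1)" for i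
  have "D (length a) \<noteq> 0"
  proof (rule continuant_nonzero)
    show "D 0 = 1" by (simp add: D_def A_def det_tridiagonal_mat_0)
    show "D 1 = b 0"
      unfolding D_def A_def det_tridiagonal_mat_1 by (simp add: b_def algebra_simps of_int_hom.map_poly_pCons_hom)
    show "D (Suc (Suc n)) = b (Suc n) * D (Suc n) + t * D n" for n
    proof -
      have "det (A (Suc (Suc n))) =
          [:- (a ! Suc n), a ! Suc n:] * det (A (Suc n)) + [:0, 1:] * det (A n)"
        unfolding A_def det_tridiagonal_mat_rec by simp
      then show ?thesis
        by (simp only: D_def of_int_poly_hom.hom_add of_int_poly_hom.hom_mult poly_add poly_mult)
          (simp add: b_def algebra_simps of_int_hom.map_poly_pCons_hom)
    qed
    show "b i \<noteq> 0" if "i < length a" for i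
      using assms(1,2) that by (simp add: b_def)
    show "cmod (t / (b i * b (Suc i))) - Re (t / (b i * b (Suc i))) \<le> 1/2"
      if "Suc i < length a" for i
    proof -
      have "t / (b i * b (Suc i)) = t / (t - 1)\<^sup>2 / of_int (a ! i * a ! Suc i)"
        by (simp add: b_def power2_eq_square mult_ac)
      with e [OF that] show ?thesis by (simp only:)
    qed
  qed
  then show ?thesis by (simp add: D_def A_def seifert_alexander_tridiagonal)
qed

text \<open>Here \<open>s = t / (t - 1)^2\<close> satisfies \<open>cmod s \<le> 1/2\<close> and
  \<open>Re s \<le> 0\<close>. For \<open>k < 0\<close> the division makes \<open>Re e\<close>
  nonnegative; for \<open>k \<ge> 2\<close> it halves the modulus, and
  \<open>cmod e - Re e \<le> 2 * cmod e\<close> suffices.\<close>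

lemma parabola_left:
  fixes t :: complex and k :: int
  assumes "Re t \<le> - 1" "k \<noteq> 0" "k \<noteq> 1"
  defines "e \<equiv> t / (t - 1)\<^sup>2 / of_int k"
  shows "cmod e - Re e \<le> 1/2"
proof -
  define s where "s = t / (t - 1)\<^sup>2"
  have "t \<noteq> 0" "t \<noteq> 1" using assms(1) by auto
  have "2 * cmod t \<le> (cmod t)\<^sup>2 + 1"
    using sum_squares_bound [of "cmod t" 1] by simp
  also have "\<dots> \<le> (cmod (t - 1))\<^sup>2"
    using assms(1) unfolding cmod_power2 by (simp add: power2_eq_square algebra_simps)
  finally have s: "cmod s \<le> 1/2"
    using \<open>t \<noteq> 1\<close> by (simp add: s_def norm_divide norm_power divide_simps)
  \<comment> \<open>Inversion preserves the sign of the real part, and \<open>inverse s\<close> is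
    simpler to estimate than \<open>s\<close>.\<close>
  have "Re (inverse t) \<le> 0"
    using assms(1) by (simp add: divide_nonpos_nonneg)
  moreover have "inverse s = t + inverse t - 2"
    using \<open>t \<noteq> 0\<close> \<open>t \<noteq> 1\<close> by (simp add: s_def field_simps power2_eq_square)
  ultimately have "Re (inverse s) \<le> 0" using assms(1) by simp
  then have "Re (inverse (inverse s)) \<le> 0"
    by (subst inverse_complex.sel) (simp only: divide_nonpos_nonneg sum_power2_ge_zero)
  then have Re_s: "Re s \<le> 0" by simp
  have "e = s / of_real (of_int k)" by (simp add: e_def s_def)
  then have e: "cmod e = cmod s / \<bar>of_int k\<bar>" "Re e = Re s / of_int k"
    by (simp_all only: norm_divide norm_of_real Re_divide_of_real)
  show ?thesis
  proof (cases "k < 0")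
    case True
    then have "Re e \<ge> 0" using Re_s by (simp add: e divide_nonpos_neg)
    moreover have "cmod s / \<bar>of_int k\<bar> \<le> cmod s / 1"
      using True by (intro divide_left_mono) simp_all
    ultimately show ?thesis using s unfolding e by linarith
  next
    case False
    then have "cmod s / \<bar>of_int k\<bar> \<le> cmod s / 2"
      using assms(2,3) by (intro divide_left_mono) simp_all
    moreover have "- Re e \<le> cmod e" using abs_Re_le_cmod by (rule abs_le_D2)
    ultimately show ?thesis using s unfolding e by linarith
  qed
qed

text \<open>The bound 3 gives \<open>cmod (t - 1) \<ge> 2\<close>, hence
  \<open>cmod t \<le> cmod (t - 1) + 1 \<le> (cmod (t - 1))^2\<close>. Thus
  \<open>cmod e \<le> 1/4\<close>, and \<open>cmod e - Re e \<le> 2 * cmod e\<close>.\<close>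

lemma parabola_right:
  fixes t :: complex and k :: int
  assumes "Re t \<ge> 3" "\<bar>k\<bar> \<ge> 4"
  defines "e \<equiv> t / (t - 1)\<^sup>2 / of_int k"
  shows "cmod e - Re e \<le> 1/2"
proof -
  have "2 \<le> cmod (t - 1)" using complex_Re_le_cmod [of "t - 1"] assms(1) by simp
  then have "2 * cmod (t - 1) \<le> (cmod (t - 1))\<^sup>2"
    unfolding power2_eq_square by (rule mult_right_mono) simp
  moreover have "cmod t \<le> cmod (t - 1) + 1"
    using norm_triangle_ineq [of "t - 1" 1] by simp
  ultimately have "cmod t \<le> (cmod (t - 1))\<^sup>2" using \<open>2 \<le> cmod (t - 1)\<close> by linarith
  then have "cmod (t / (t - 1)\<^sup>2) \<le> 1"
    using \<open>2 \<le> cmod (t - 1)\<close> by (simp add: norm_divide norm_power divide_simps)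
  then have "cmod e \<le> 1 / \<bar>of_int k\<bar>"
    unfolding e_def norm_divide [of _ "of_int k"] norm_of_int by (rule divide_right_mono) simp
  also have "\<dots> \<le> 1 / 4" using assms(2) by (intro divide_left_mono) auto
  finally have "cmod e \<le> 1 / 4" .
  moreover have "- Re e \<le> cmod e" using abs_Re_le_cmod by (rule abs_le_D2)
  ultimately show ?thesis by simp
qed

theorem theorem3:
  fixes a :: "int list" and r :: rat
  assumes "a \<noteq> []"
    and "\<forall>x \<in> set a. x \<noteq> 0"
    and "r = even_cf a"
    and "\<forall>i. i + 1 < length a \<longrightarrow> a ! i * a ! (i + 1) \<noteq> 1"
  shows "(\<forall>\<alpha>::complex. poly (map_poly of_int (alexander_two_bridge r)) \<alpha> = 0 \<longrightarrow> Re \<alpha> > - 1)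
    \<and> ((\<forall>x \<in> set a. \<bar>x\<bar> > 1) \<longrightarrow>
        (\<forall>\<alpha>::complex. poly (map_poly of_int (alexander_two_bridge r)) \<alpha> = 0
           \<longrightarrow> - 1 < Re \<alpha> \<and> Re \<alpha> < 3))"
proof -
  have eq: "alexander_two_bridge r = seifert_alexander (seifert_matrix a)"
    by (rule alexander_two_bridge_eq) (use assms in \<open>simp add: even_expansion_def\<close>)
  have left: "Re \<alpha> > - 1" if "poly (map_poly of_int (alexander_two_bridge r)) \<alpha> = 0" for \<alpha> :: complex
  proof (rule ccontr)
    assume "\<not> Re \<alpha> > - 1"
    then have "Re \<alpha> \<le> - 1" by simp
    \<comment> \<open>Away from 1, the diagonal entries \<open>a_i (\<alpha> - 1)\<close> do not
      vanish.\<close>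
    moreover from this have "\<alpha> \<noteq> 1" by auto
    ultimately have "poly (map_poly of_int (seifert_alexander (seifert_matrix a))) \<alpha> \<noteq> 0"
      using assms(2,4) by (intro seifert_alexander_nonzero parabola_left) auto
    with that eq show False by simp
  qed
  have right: "Re \<alpha> < 3"
    if big: "\<forall>x \<in> set a. \<bar>x\<bar> > 1"
      and root: "poly (map_poly of_int (alexander_two_bridge r)) \<alpha> = 0" for \<alpha> :: complex
  proof (rule ccontr)
    assume "\<not> Re \<alpha> < 3"
    then have "Re \<alpha> \<ge> 3" by simp
    moreover from this have "\<alpha> \<noteq> 1" by auto
    \<comment> \<open>The role of \<open>k\<close> in \<open>parabola_right\<close> is taken by the
      product of two neighbouring entries.\<close>
    moreover have "\<bar>a ! i * a ! Suc i\<bar> \<ge> 4" if "Suc i < length a" for i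
    proof -
      have "\<bar>a ! i\<bar> \<ge> 2" "\<bar>a ! Suc i\<bar> \<ge> 2"
        using big nth_mem [of i a] nth_mem [OF that] that by fastforce+
      then have "2 * 2 \<le> \<bar>a ! i\<bar> * \<bar>a ! Suc i\<bar>" by (intro mult_mono) simp_all
      then show ?thesis by (simp add: abs_mult)
    qed
    ultimately have "poly (map_poly of_int (seifert_alexander (seifert_matrix a))) \<alpha> \<noteq> 0"
      using assms(2) by (intro seifert_alexander_nonzero parabola_right) auto
    with root eq show False by simp
  qed
  show ?thesis using left right by blast
qed

end
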